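(* For every integer $n\ge 2$, the class $\mathcal C_n$ is the set of all real symmetric circulant matrices of order $n$, that is, $\mathcal C_n=\mathcal H_{n,n-1}$.
   Context: Rows, columns and vector components are indexed by $0,1,\dots,n-1$. $Q_n$ is the real $n\times n$ matrix whose columns $\mathbf q^{(0)},\dots,\mathbf q^{(n-1)}$ are as follows: $\mathbf q^{(0)}=\frac1{\sqrt n}(1,\dots,1)^T$; for $1\le j\le\lfloor\frac{n-1}2\rfloor$, $\mathbf q^{(j)}$ has $k$-th entry $\sqrt{2/n}\,\cos(2\pi kj/n)$ and $\mathbf q^{(n-j)}$ has $k$-th entry $\sqrt{2/n}\,\sin(2\pi kj/n)$, $k=0,\dots,n-1$; if $n$ is even, $\mathbf q^{(n/2)}$ has $k$-th entry $(-1)^k/\sqrt n$. ($Q_n$ is orthogonal.) A vector $\mathbf x=(x_0,\dots,x_{n-1})^T\in\mathbb R^n$ is symmetric if $x_j=x_{(n-j)\bmod n}$ for all $j$. Define $\mathcal C_n=\{Q_n\,\mathrm{diag}(\boldsymbol\lambda)\,Q_n^T:\boldsymbol\lambda\in\mathbb R^n\text{ symmetric}\}$. $\mathcal H_{n,n-1}$ is the set of all $A=(a_{l,j})\in\mathbb R^{n\times n}$ for which there is a symmetric $\mathbf a=(a_0,\dots,a_{n-1})^T\in\mathbb R^n$ with $a_{l,j}=a_{(j+(n-1)l)\bmod n}=a_{(j-l)\bmod n}$ for all $l,j$; this is the set of real symmetric circulant matrices. *)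

theory Defs
  imports Complex_Main "Jordan_Normal_Form.Matrix"
begin

definition Q_col :: "nat \<Rightarrow> nat \<Rightarrow> real vec" where
  "Q_col n j = vec n (\<lambda>k.
     if j = 0 then 1 / sqrt (real n)
     else if j \<le> (n - 1) div 2 then
       sqrt (2 / real n) * cos (2 * pi * real k * real j / real n)
     else if 2 * j = n then (-1) ^ k / sqrt (real n)
     else sqrt (2 / real n) * sin (2 * pi * real k * real (n - j) / real n))"

text \<open>The final branch above is the column with index \<open>n - i\<close> for
  \<open>1 \<le> i \<le> (n - 1) div 2\<close>:\<close>

lemma Q_col_sin:
  assumes "1 \<le> i" "i \<le> (n - 1) div 2"
  shows "Q_col n (n - i) =
    vec n (\<lambda>k. sqrt (2 / real n) * sin (2 * pi * real k * real i / real n))"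
proof -
  have "i < n" "n - i \<noteq> 0" "\<not> n - i \<le> (n - 1) div 2" "2 * (n - i) \<noteq> n" "n - (n - i) = i"
    using assms by linarith+
  then show ?thesis
    by (simp add: Q_col_def)
qed

definition Q_mat :: "nat \<Rightarrow> real mat" where
  "Q_mat n = mat_of_cols n (map (Q_col n) [0..<n])"

definition symmetric_vec :: "'a vec \<Rightarrow> bool" where
  "symmetric_vec x \<longleftrightarrow> (\<forall>j<dim_vec x. x $ j = x $ ((dim_vec x - j) mod dim_vec x))"

definition C_class :: "nat \<Rightarrow> real mat set" where
  "C_class n = {Q_mat n * mat_diag n (($) x) * transpose_mat (Q_mat n) | x.
     x \<in> carrier_vec n \<and> symmetric_vec x}"

definition H_class :: "nat \<Rightarrow> nat \<Rightarrow> real mat set" where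
  "H_class n k = {A \<in> carrier_mat n n. \<exists>a \<in> carrier_vec n. symmetric_vec a \<and>
     (\<forall>l<n. \<forall>j<n. A $$ (l, j) = a $ ((j + k * l) mod n))}"

text \<open>The difference of the indices is taken in the integers, since it may be negative.\<close>

definition circulant_mat :: "'a mat \<Rightarrow> bool" where
  "circulant_mat A \<longleftrightarrow> square_mat A \<and> (\<exists>a \<in> carrier_vec (dim_row A).
     \<forall>l<dim_row A. \<forall>j<dim_row A.
       A $$ (l, j) = a $ nat ((int j - int l) mod int (dim_row A)))"

end

theory Submission
  imports Defs "HOL-Number_Theory.Cong"
begin

text \<open>Averaging over the involution \<open>m \<mapsto> -m\<close> of the column indices modulo \<open>n\<close> pairs the cosine column
  \<open>m\<close> with the sine column \<open>n - m\<close>, so that the addition theorem gives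
  \<open>(Q diag(x) Q\<^sup>T)\<^sub>l\<^sub>j = (1/n) \<Sum>\<^sub>m x\<^sub>m cos (2\<pi>m(j - l)/n)\<close> for symmetric \<open>x\<close>: a symmetric circulant. Conversely,
  up to the factor \<open>1/n\<close> the discrete cosine transform is an involution on symmetric vectors, so
  every symmetric circulant arises in this way.\<close>

section \<open>Cosine sums and negation of indices modulo \<open>n\<close>\<close>

text \<open>The argument is an integer, so that negative index differences and congruences modulo
  \<open>n\<close> apply to it directly.\<close>

definition dcos :: "nat \<Rightarrow> int \<Rightarrow> real" where
  "dcos n k = cos (2 * pi * real_of_int k / real n)"

lemma dcos_cong:
  assumes "n > 0" "[k = k'] (mod int n)"
  shows "dcos n k = dcos n k'"
proof -
  obtain q where q: "k = k' + int n * q"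
    using assms(2) by (metis cong_iff_lin cong_sym)
  have "2 * pi * real_of_int k / real n = 2 * pi * real_of_int k' / real n + 2 * pi * real_of_int q"
    using assms(1) by (simp add: q field_simps)
  then show ?thesis
    unfolding dcos_def by (simp only: cos_add cos_int_2pin sin_int_2pin mult_1_right mult_zero_right diff_zero)
qed

lemma dcos_uminus [simp]: "dcos n (- k) = dcos n k"
  by (simp add: dcos_def)

lemma dcos_mult: "dcos n k * dcos n l = (dcos n (k - l) + dcos n (k + l)) / 2"
  by (simp add: dcos_def cos_times_cos ring_distribs diff_divide_distrib add_divide_distrib)

text \<open>Real part of a geometric sum: \<open>z = cis (2 * pi * k / n)\<close> satisfies
  \<open>z ^ n = 1\<close>, and \<open>z\<close> differs from 1 unless \<open>n\<close> divides
  \<open>k\<close>.\<close>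

lemma sum_dcos:
  assumes "n > 0"
  shows "(\<Sum>m<n. dcos n (int m * k)) = (if int n dvd k then real n else 0)"
proof (cases "int n dvd k")
  case True
  have "dcos n (int m * k) = 1" for m
  proof -
    have "dcos n (int m * k) = dcos n 0"
      using True by (intro dcos_cong[OF assms]) (simp add: cong_0_iff)
    then show ?thesis by (simp add: dcos_def)
  qed
  then show ?thesis using True by simp
next
  case False
  define z where "z = cis (2 * pi * real_of_int k / real n)"
  have zm: "z ^ m = cis (2 * pi * real_of_int (int m * k) / real n)" for m
    unfolding z_def DeMoivre by (simp add: mult_ac)
  have "z ^ n = cis (2 * pi * real_of_int k)"
    unfolding z_def DeMoivre using assms by simp
  then have zn: "z ^ n = 1" by (simp add: cis_multiple_2pi)
  have "z \<noteq> 1"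
  proof
    assume "z = 1"
    then have "cos (2 * pi * real_of_int k / real n) = 1"
      unfolding z_def by (metis cis.sel(1) one_complex.sel(1))
    then obtain q :: int where "2 * pi * real_of_int k / real n = real_of_int q * 2 * pi"
      using cos_one_2pi_int by blast
    then have "real_of_int k = real_of_int (q * int n)"
      using assms by (simp add: field_simps)
    then have "k = q * int n" by (simp only: of_int_eq_iff)
    with False show False by simp
  qed
  then have "(\<Sum>m<n. z ^ m) = 0"
    by (simp add: geometric_sum zn)
  then have "Re (\<Sum>m<n. z ^ m) = 0" by simp
  then show ?thesis
    using False by (simp add: zm dcos_def)
qed

text \<open>Negation modulo \<open>n\<close> is an involution of the indices; the \<open>mod\<close>
  sends 0 to itself instead of to \<open>n\<close>.\<close>

lemma sum_neg_mod:
  fixes f :: "nat \<Rightarrow> 'a::comm_monoid_add"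
  shows "(\<Sum>m<n. f ((n - m) mod n)) = (\<Sum>m<n. f m)"
proof -
  have "(n - (n - m) mod n) mod n = m" if "m < n" for m
    using that by (cases "m = 0") auto
  then show ?thesis
    by (intro sum.reindex_bij_witness[where i = "\<lambda>m. (n - m) mod n" and j = "\<lambda>m. (n - m) mod n"])
      auto
qed

lemma symmetric_vecD:
  assumes "symmetric_vec x" "x \<in> carrier_vec n" "j < n"
  shows "x $ ((n - j) mod n) = x $ j"
  using assms unfolding symmetric_vec_def by (metis carrier_vecD)

section \<open>Products of entries in the columns of \<open>Q_mat n\<close>\<close>

lemma Q_mat_carrier [simp]: "Q_mat n \<in> carrier_mat n n"
  unfolding Q_mat_def by (rule mat_of_cols_carrier[of n "map (Q_col n) [0..<n]", simplified])

lemma dim_Q_mat [simp]: "dim_row (Q_mat n) = n" "dim_col (Q_mat n) = n"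
  using carrier_matD[OF Q_mat_carrier] by simp_all

lemma Q_mat_index:
  assumes "k < n" "j < n"
  shows "Q_mat n $$ (k, j) = Q_col n j $ k"
  using assms by (simp add: Q_mat_def mat_of_cols_index)

text \<open>Both columns have frequency \<open>i\<close>, so the subtraction formula for the cosine
  leaves only the difference of the row indices.\<close>

lemma Q_col_mult_cos_sin:
  assumes "1 \<le> i" "i \<le> (n - 1) div 2" "k < n" "l < n"
  shows "Q_col n i $ k * Q_col n i $ l + Q_col n (n - i) $ k * Q_col n (n - i) $ l
    = 2 / real n * dcos n (int i * (int l - int k))"
proof -
  let ?a = "2 * pi * real k * real i / real n" and ?b = "2 * pi * real l * real i / real n"
  let ?s = "sqrt (2 / real n)"
  have "Q_col n i $ k * Q_col n i $ l + Q_col n (n - i) $ k * Q_col n (n - i) $ l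
    = (?s * cos ?a) * (?s * cos ?b) + (?s * sin ?a) * (?s * sin ?b)"
    using assms unfolding Q_col_sin[OF assms(1,2)] by (simp add: Q_col_def)
  also have "\<dots> = (?s * ?s) * (cos ?b * cos ?a + sin ?b * sin ?a)"
    by (simp only: ring_distribs mult_ac)
  also have "\<dots> = 2 / real n * cos (?b - ?a)"
    by (simp add: cos_diff)
  also have "?b - ?a = 2 * pi * real_of_int (int i * (int l - int k)) / real n"
    by (simp add: algebra_simps diff_divide_distrib)
  finally show ?thesis by (simp add: dcos_def)
qed

text \<open>Makes the pairing uniform in \<open>m\<close>. The indices 0 and \<open>n / 2\<close>
  are their own negatives, so their column is counted twice, which yields the same factor
  \<open>2 / n\<close> as a cosine-sine pair.\<close>

lemma Q_col_mult_neg_mod: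
  assumes "m < n" "k < n" "l < n"
  shows "Q_col n m $ k * Q_col n m $ l
      + Q_col n ((n - m) mod n) $ k * Q_col n ((n - m) mod n) $ l
    = 2 / real n * dcos n (int m * (int l - int k))"
proof -
  consider "m = 0" | "1 \<le> m" "m \<le> (n - 1) div 2" | "2 * m = n" "m > 0"
    | "1 \<le> n - m" "n - m \<le> (n - 1) div 2" "m > 0"
    using assms(1) by linarith
  then show ?thesis
  proof cases
    case 1
    then show ?thesis using assms by (simp add: Q_col_def dcos_def)
  next
    case 2
    then show ?thesis using Q_col_mult_cos_sin[OF 2 assms(2,3)] by simp
  next
    case 3
    \<comment> \<open>Since \<open>n = 2 * m\<close>, the angle is a multiple of pi: its cosine
      splits into signs, as the sines vanish.\<close>
    have "2 * pi * real_of_int (int m * (int l - int k)) / (2 * real m) = pi * real l - pi * real k"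
      using 3 by (simp add: field_simps)
    then have "dcos n (int m * (int l - int k)) = cos (pi * real l - pi * real k)"
      using 3(1) by (auto simp: dcos_def)
    also have "\<dots> = (-1) ^ l * (-1) ^ k"
      by (simp add: cos_diff)
    finally have d: "dcos n (int m * (int l - int k)) = (-1) ^ l * (-1) ^ k" .
    have m: "(n - m) mod n = m" and "\<not> m \<le> (n - 1) div 2" using 3 by auto
    then have "Q_col n m $ i = (-1) ^ i / sqrt (real n)" if "i < n" for i
      using that 3 by (simp add: Q_col_def)
    then show ?thesis
      using assms by (simp add: m d)
  next
    case 4
    have m: "(n - m) mod n = n - m" "n - (n - m) = m" using 4 assms by auto
    \<comment> \<open>For a sine column \<open>m\<close>, the pairing is applied with
      \<open>i = n - m\<close>; periodicity and evenness of the cosine bring the frequency back to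
      \<open>m\<close>.\<close>
    have "dcos n (int (n - m) * (int l - int k)) = dcos n (- (int m * (int l - int k)))"
    proof (rule dcos_cong)
      have "int (n - m) * (int l - int k) - - (int m * (int l - int k)) = int n * (int l - int k)"
        using assms(1) by (simp add: of_nat_diff algebra_simps)
      then show "[int (n - m) * (int l - int k) = - (int m * (int l - int k))] (mod int n)"
        by (simp only: cong_iff_dvd_diff dvd_triv_left)
    qed (use assms in simp)
    then show ?thesis
      using Q_col_mult_cos_sin[OF 4(1,2) assms(2,3)] by (simp add: m add.commute)
  qed
qed

lemma Q_diag_Q_index:
  assumes "x \<in> carrier_vec n" "symmetric_vec x" "l < n" "j < n"
  shows "(Q_mat n * mat_diag n (($) x) * transpose_mat (Q_mat n)) $$ (l, j)
    = (\<Sum>m<n. x $ m * dcos n (int m * (int j - int l))) / real n"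
proof -
  let ?P = "\<lambda>m. Q_col n m $ l * Q_col n m $ j"
  have "Q_mat n * mat_diag n (($) x) = mat n n (\<lambda>(i, j). Q_mat n $$ (i, j) * x $ j)"
    by (rule mat_diag_mult_right) simp
  then have L: "(Q_mat n * mat_diag n (($) x) * transpose_mat (Q_mat n)) $$ (l, j)
      = (\<Sum>m<n. x $ m * ?P m)" (is "?L = ?S")
    using assms
    by (simp add: scalar_prod_def Q_mat_index mult_ac atLeast0LessThan)
  \<comment> \<open>Of two copies of the sum one is reindexed by negation; symmetry of
    \<open>x\<close> gives columns \<open>m\<close> and \<open>- m\<close> the same weight, so their
    products can be combined.\<close>
  have "2 * ?S = ?S + (\<Sum>m<n. x $ ((n - m) mod n) * ?P ((n - m) mod n))"
    using sum_neg_mod[of "\<lambda>m. x $ m * ?P m" n] by simp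
  also have "\<dots> = (\<Sum>m<n. x $ m * (?P m + ?P ((n - m) mod n)))"
    by (simp add: symmetric_vecD[OF assms(2,1)] distrib_left sum.distrib)
  also have "\<dots> = (\<Sum>m<n. x $ m * (2 / real n * dcos n (int m * (int j - int l))))"
    using assms by (simp add: Q_col_mult_neg_mod)
  also have "\<dots> = 2 * ((\<Sum>m<n. x $ m * dcos n (int m * (int j - int l))) / real n)"
    by (simp add: sum_distrib_left sum_divide_distrib mult_ac)
  finally show ?thesis unfolding L by simp
qed

section \<open>The discrete cosine transform\<close>

text \<open>Unnormalised; on symmetric vectors it is the discrete Fourier transform, whose sine
  terms cancel there.\<close>

definition dct :: "real vec \<Rightarrow> real vec" where
  "dct x = vec (dim_vec x) (\<lambda>d. \<Sum>m<dim_vec x. x $ m * dcos (dim_vec x) (int m * int d))"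

lemma dct_carrier [simp]: "dct x \<in> carrier_vec n \<longleftrightarrow> x \<in> carrier_vec n"
  by (simp add: dct_def flip: carrier_dim_vec)

text \<open>Any integer representing \<open>d\<close> modulo \<open>n\<close> may serve as
  frequency, in particular \<open>- d\<close> or \<open>j - l\<close> for a reduced index.\<close>

lemma dct_index:
  assumes "x \<in> carrier_vec n" "d < n" "[k = int d] (mod int n)"
  shows "dct x $ d = (\<Sum>m<n. x $ m * dcos n (int m * k))"
proof -
  have "dcos n (int m * int d) = dcos n (int m * k)" for m
    using assms by (intro dcos_cong cong_scalar_left cong_sym[OF assms(3)]) simp
  then show ?thesis using assms by (simp add: dct_def)
qed

lemma cong_neg_mod:
  assumes "d < n"
  shows "[- int d = int ((n - d) mod n)] (mod int n)"
proof -
  have "- int d - int (n - d) = int n * (- 1)"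
    using assms by (simp add: of_nat_diff)
  then have "[- int d = int (n - d)] (mod int n)"
    by (simp only: cong_iff_dvd_diff dvd_triv_left)
  then show ?thesis by (simp add: cong_def zmod_int)
qed

text \<open>The cosine is even, and the index \<open>(n - d) mod n\<close> represents
  \<open>- d\<close>.\<close>

lemma symmetric_dct [simp]: "symmetric_vec (dct x)"
proof -
  define n where "n = dim_vec x"
  have x: "x \<in> carrier_vec n" unfolding n_def by (rule carrier_vec_dim_vec)
  have "dct x $ ((n - d) mod n) = dct x $ d" if d: "d < n" for d
  proof -
    have "(n - d) mod n < n" using d by simp
    then have "dct x $ ((n - d) mod n) = (\<Sum>m<n. x $ m * dcos n (int m * - int d))"
      by (rule dct_index[OF x _ cong_neg_mod[OF d]])
    also have "\<dots> = dct x $ d"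
      by (simp add: dct_index[OF x d cong_refl])
    finally show ?thesis .
  qed
  moreover have "dim_vec (dct x) = n" by (simp add: dct_def n_def)
  ultimately show ?thesis by (simp add: symmetric_vec_def)
qed

text \<open>The product-to-sum formula and \<open>sum_dcos\<close> show that the double transform
  selects the entries of \<open>x\<close> at \<open>e\<close> and \<open>- e\<close>, each with
  weight \<open>n / 2\<close>; by symmetry they agree.\<close>

lemma dct_dct:
  assumes x: "x \<in> carrier_vec n" and sym: "symmetric_vec x"
  shows "dct (dct x) = real n \<cdot>\<^sub>v x"
proof (rule eq_vecI)
  fix e assume "e < dim_vec (real n \<cdot>\<^sub>v x)"
  then have e: "e < n" using x by simp
  \<comment> \<open>The two conditions contribute separately because they coincide when
    \<open>e\<close> is 0 or \<open>n / 2\<close>, and then both weights count.\<close>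
  have orth: "(\<Sum>d<n. dcos n (int m * int d) * dcos n (int d * int e))
      = (if m = e then real n / 2 else 0) + (if m = (n - e) mod n then real n / 2 else 0)"
    if m: "m < n" for m
  proof -
    have "(\<Sum>d<n. dcos n (int m * int d) * dcos n (int d * int e))
      = ((\<Sum>d<n. dcos n (int d * (int m - int e))) + (\<Sum>d<n. dcos n (int d * (int m + int e)))) / 2"
      unfolding sum_divide_distrib sum.distrib[symmetric]
      by (intro sum.cong refl)
        (simp add: dcos_mult right_diff_distrib distrib_left mult.commute[of "int m"])
    moreover have "int n dvd int m - int e \<longleftrightarrow> m = e"
      using m e by (simp add: cong_int_iff cong_def flip: cong_iff_dvd_diff)
    moreover have "int n dvd int m + int e \<longleftrightarrow> m = (n - e) mod n"
    proof -
      have "int n dvd int m + int e \<longleftrightarrow> [int m = - int e] (mod int n)"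
        by (simp add: cong_iff_dvd_diff)
      also have "\<dots> \<longleftrightarrow> [int m = int ((n - e) mod n)] (mod int n)"
        using cong_neg_mod[OF e] cong_trans cong_sym by blast
      also have "\<dots> \<longleftrightarrow> m = (n - e) mod n"
        using m by (simp add: cong_int_iff cong_def)
      finally show ?thesis .
    qed
    moreover have "n > 0" using e by simp
    ultimately show ?thesis
      by (simp only: sum_dcos) simp
  qed
  have "dct (dct x) $ e = (\<Sum>d<n. dct x $ d * dcos n (int d * int e))"
    using x e by (intro dct_index) simp_all
  also have "\<dots> = (\<Sum>d<n. \<Sum>m<n. x $ m * (dcos n (int m * int d) * dcos n (int d * int e)))"
    using x by (simp add: dct_index[OF x _ cong_refl] sum_distrib_left sum_distrib_right mult_ac)
  also have "\<dots> = (\<Sum>m<n. x $ m * (\<Sum>d<n. dcos n (int m * int d) * dcos n (int d * int e)))"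
    by (subst sum.swap) (simp add: sum_distrib_left)
  also have "\<dots> = (\<Sum>m<n. (if m = e then x $ m * (real n / 2) else 0))
      + (\<Sum>m<n. (if m = (n - e) mod n then x $ m * (real n / 2) else 0))"
    unfolding sum.distrib[symmetric] by (intro sum.cong refl) (simp add: orth distrib_left)
  also have "\<dots> = real n * x $ e"
    using e symmetric_vecD[OF sym x e] by simp
  finally show "dct (dct x) $ e = (real n \<cdot>\<^sub>v x) $ e" using x e by simp
qed (use x in \<open>simp add: dct_def\<close>)

section \<open>Index arithmetic of symmetric circulants\<close>

lemma cong_int_modD:
  fixes a b n :: nat
  assumes "[int (a mod n) = int (b mod n)] (mod int n)"
  shows "a mod n = b mod n"
  using assms unfolding cong_int_iff by (simp add: cong_def)

text \<open>Here \<open>n - 1\<close> acts as -1 modulo \<open>n\<close>; the bound on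
  \<open>l\<close> makes \<open>n\<close> positive, so this subtraction does not truncate.\<close>

lemma cong_circulant_index:
  fixes n :: nat
  assumes "l < n"
  shows "[int j - int l = int ((j + (n - 1) * l) mod n)] (mod int n)"
proof -
  have "int j - int l - int (j + (n - 1) * l) = int n * (- int l)"
    using assms by (simp add: of_nat_diff left_diff_distrib)
  then have "[int j - int l = int (j + (n - 1) * l)] (mod int n)"
    by (simp only: cong_iff_dvd_diff dvd_triv_left)
  then show ?thesis by (simp add: cong_def zmod_int)
qed

lemma nat_circulant_index:
  fixes n :: nat
  assumes "l < n"
  shows "nat ((int j - int l) mod int n) = (j + (n - 1) * l) mod n"
proof -
  have "(int j - int l) mod int n = int ((j + (n - 1) * l) mod n)"
    using cong_circulant_index[OF assms, of j] by (simp only: cong_def zmod_int mod_mod_trivial)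
  then show ?thesis by (simp only: nat_int)
qed

text \<open>Transposition turns the index \<open>j - l\<close> of the generating vector into its
  negative, so symmetry of the matrix amounts to symmetry of that vector.\<close>

lemma H_class_eq_symmetric_circulant:
  "H_class n (n - 1) = {A \<in> carrier_mat n n. transpose_mat A = A \<and> circulant_mat A}"
proof (intro equalityI subsetI)
  fix A :: "real mat" assume "A \<in> H_class n (n - 1)"
  then obtain a where A: "A \<in> carrier_mat n n" and a: "a \<in> carrier_vec n" "symmetric_vec a"
    and Aa: "\<And>l j. l < n \<Longrightarrow> j < n \<Longrightarrow> A $$ (l, j) = a $ ((j + (n - 1) * l) mod n)"
    unfolding H_class_def by blast
  have "A $$ (l, j) = A $$ (j, l)" if lj: "l < n" "j < n" for l j
  proof -
    let ?d = "(j + (n - 1) * l) mod n"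
    have "?d < n" using lj by simp
    \<comment> \<open>The position that \<open>(j, l)\<close> reads in \<open>a\<close> is the
      negative of the position \<open>?d\<close> read by \<open>(l, j)\<close>.\<close>
    have "[int ((l + (n - 1) * j) mod n) = - (int j - int l)] (mod int n)"
      using cong_circulant_index[OF lj(2), of l] by (simp add: cong_sym)
    also have "[- (int j - int l) = - int ?d] (mod int n)"
      using cong_circulant_index[OF lj(1), of j] by (simp only: cong_minus_minus_iff)
    also have "[- int ?d = int ((n - ?d) mod n)] (mod int n)"
      by (rule cong_neg_mod) fact
    finally have "(l + (n - 1) * j) mod n = (n - ?d) mod n"
      by (rule cong_int_modD)
    then show ?thesis
      using Aa lj symmetric_vecD[OF a(2,1) \<open>?d < n\<close>] by simp
  qed
  then have "transpose_mat A = A" using A by (intro eq_matI) auto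
  moreover have "circulant_mat A"
    using A a(1) Aa by (auto simp: circulant_mat_def nat_circulant_index)
  ultimately show "A \<in> {A \<in> carrier_mat n n. transpose_mat A = A \<and> circulant_mat A}"
    using A by simp
next
  fix A :: "real mat" assume "A \<in> {A \<in> carrier_mat n n. transpose_mat A = A \<and> circulant_mat A}"
  then have A: "A \<in> carrier_mat n n" and T: "transpose_mat A = A" and C: "circulant_mat A" by auto
  from C A obtain a where a: "a \<in> carrier_vec n"
    and Aa: "\<And>l j. l < n \<Longrightarrow> j < n \<Longrightarrow> A $$ (l, j) = a $ ((j + (n - 1) * l) mod n)"
    by (auto simp: circulant_mat_def nat_circulant_index)
  have "a $ ((n - j) mod n) = a $ j" if j: "j < n" for j
  proof -
    \<comment> \<open>Row 0 lists \<open>a\<close>, and column 0 lists \<open>a\<close> at the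
      negated indices.\<close>
    have "A $$ (0, j) = A $$ (j, 0)"
      using A T j by (metis carrier_matD index_transpose_mat(1) less_nat_zero_code neq0_conv)
    moreover have "[int ((0 + (n - 1) * j) mod n) = int ((n - j) mod n)] (mod int n)"
      using cong_trans[OF cong_sym[OF cong_circulant_index[OF j, of 0]]] cong_neg_mod[OF j] by simp
    then have "(0 + (n - 1) * j) mod n = (n - j) mod n"
      by (rule cong_int_modD)
    ultimately show ?thesis using Aa[of 0 j] Aa[of j 0] j by simp
  qed
  then have "symmetric_vec a" using a by (simp add: symmetric_vec_def)
  then show "A \<in> H_class n (n - 1)"
    using A a Aa unfolding H_class_def by blast
qed

section \<open>Equality of the two classes\<close>

lemma Q_diag_Q_index_dct:
  assumes "x \<in> carrier_vec n" "symmetric_vec x" "l < n" "j < n"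
  shows "(Q_mat n * mat_diag n (($) x) * transpose_mat (Q_mat n)) $$ (l, j)
    = dct x $ ((j + (n - 1) * l) mod n) / real n"
  using Q_diag_Q_index[OF assms] dct_index[OF assms(1) _ cong_circulant_index[OF assms(3)], of j]
    assms(3) by simp

lemma symmetric_vec_smult:
  assumes "symmetric_vec x"
  shows "symmetric_vec (c \<cdot>\<^sub>v x)"
  unfolding symmetric_vec_def index_smult_vec
proof (intro allI impI)
  fix j assume j: "j < dim_vec x"
  then have "x $ ((dim_vec x - j) mod dim_vec x) = x $ j" and "(dim_vec x - j) mod dim_vec x < dim_vec x"
    using assms by (auto dest: symmetric_vecD[OF _ carrier_vec_dim_vec])
  with j show "(c \<cdot>\<^sub>v x) $ j = (c \<cdot>\<^sub>v x) $ ((dim_vec x - j) mod dim_vec x)" by simp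
qed

lemma C_class_eq_H_class: "C_class n = H_class n (n - 1)"
proof (intro equalityI subsetI)
  fix A assume "A \<in> C_class n"
  then obtain x where x: "x \<in> carrier_vec n" "symmetric_vec x"
    and A: "A = Q_mat n * mat_diag n (($) x) * transpose_mat (Q_mat n)"
    unfolding C_class_def by blast
  have "A \<in> carrier_mat n n"
    unfolding A by (intro carrier_matI) simp_all
  \<comment> \<open>The candidate for the generating vector is the first row: the transformed
    eigenvalues divided by \<open>n\<close>.\<close>
  moreover let ?a = "(1 / real n) \<cdot>\<^sub>v dct x"
  have "dim_vec (dct x) = n" using x by (simp add: dct_def)
  then have "A $$ (l, j) = ?a $ ((j + (n - 1) * l) mod n)" if "l < n" "j < n" for l j
    using that Q_diag_Q_index_dct[OF x that] by (simp add: A)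
  moreover have "?a \<in> carrier_vec n" "symmetric_vec ?a"
    using x by (simp_all add: symmetric_vec_smult)
  ultimately show "A \<in> H_class n (n - 1)"
    unfolding H_class_def by (intro CollectI conjI bexI[of _ ?a] allI impI)
next
  fix A :: "real mat" assume "A \<in> H_class n (n - 1)"
  then obtain a where A: "A \<in> carrier_mat n n" and a: "a \<in> carrier_vec n" "symmetric_vec a"
    and Aa: "\<And>l j. l < n \<Longrightarrow> j < n \<Longrightarrow> A $$ (l, j) = a $ ((j + (n - 1) * l) mod n)"
    unfolding H_class_def by blast
  \<comment> \<open>The eigenvalues are to be \<open>dct a\<close>: transforming once more and
    dividing by \<open>n\<close> returns \<open>a\<close>.\<close>
  let ?B = "Q_mat n * mat_diag n (($) (dct a)) * transpose_mat (Q_mat n)"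
  have x: "dct a \<in> carrier_vec n" using a by simp
  have "A = ?B"
  proof (rule eq_matI)
    fix l j assume "l < dim_row ?B" "j < dim_col ?B"
    then have lj: "l < n" "j < n" by simp_all
    show "A $$ (l, j) = ?B $$ (l, j)"
      using lj a Aa[OF lj] Q_diag_Q_index_dct[OF x symmetric_dct lj] by (simp add: dct_dct)
  qed (use A in auto)
  then show "A \<in> C_class n"
    unfolding C_class_def using x symmetric_dct by blast
qed

theorem corollary3p4p1:
  fixes n :: nat
  assumes "n \<ge> 2"
  shows "C_class n = {A \<in> carrier_mat n n. transpose_mat A = A \<and> circulant_mat A} \<and>
    C_class n = H_class n (n - 1)"
  by (simp only: C_class_eq_H_class H_class_eq_symmetric_circulant)

end
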